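(* Let $k\ge1$ be an integer. We have $$G^{(k-1)(k-2)\cdots1k}_{13\text{-}2}(x)=x^kC^2(x),$$ where $C^2(x)=(C(x))^2$. Hence $$N^{(k-1)(k-2)\cdots1k}_{13\text{-}2}(n)=\begin{cases}C_{n-(k-1)},&\text{if }n\ge k,\\0,&\text{otherwise.}\end{cases}$$
   Context: A permutation $\pi=\pi_1\cdots\pi_n$ of $\{1,\dots,n\}$ contains the generalized pattern $13\text{-}2$ if there are indices $i,j$ with $i+1<j\le n$ such that $\pi_i\pi_{i+1}\pi_j$ is order-isomorphic to $132$; otherwise it avoids it. A permutation $\pi$ begins with a pattern $p=p_1\cdots p_k$ if $n\ge k$ and $\pi_1\cdots\pi_k$ is order-isomorphic to $p$; in addition, by convention, the empty permutation is assumed to begin with the pattern $1$. The pattern $(k-1)(k-2)\cdots1k$ consists of $k-1,k-2,\dots,1$ in decreasing order followed by $k$ (for $k=1$ it is $1$, for $k=2$ it is $12$). $N^p_q(n)$ is the number of permutations of $\{1,\dots,n\}$ that avoid $q$ and begin with $p$, and $G^p_q(x)=\sum_{n\ge0}N^p_q(n)x^n$ is the ordinary generating function. $C(x)=\sum_{n\ge0}C_nx^n=\frac{1-\sqrt{1-4x}}{2x}$, with $C_n=\frac1{n+1}\binom{2n}{n}$ the Catalan numbers.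
   Formalization: For k=1 the printed formulas fail at n=0: by convention the empty permutation begins with the pattern 1, so N(0)=1 and G(x)=1+xC²(x). The formal statement adds 1 to the series when k=1 and 1 to the count when k=1, n=0; all other cases are as printed. *)

theory Defs
  imports Complex_Main
    "HOL-Combinatorics.Multiset_Permutations"
    "HOL-Computational_Algebra.Formal_Power_Series"
begin

definition order_isomorphic :: "nat list \<Rightarrow> nat list \<Rightarrow> bool" where
  "order_isomorphic xs ys \<longleftrightarrow>
     length xs = length ys \<and>
     (\<forall>i<length xs. \<forall>j<length xs. xs ! i < xs ! j \<longleftrightarrow> ys ! i < ys ! j)"

text \<open>Permutations are words in one-line notation. List positions count from \<open>0\<close>, so
  \<open>j < length \<pi>\<close> corresponds to \<open>j \<le> n\<close> for positions counted from \<open>1\<close>.\<close>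

definition contains_13_2 :: "nat list \<Rightarrow> bool" where
  "contains_13_2 \<pi> \<longleftrightarrow>
     (\<exists>i j. i + 1 < j \<and> j < length \<pi> \<and>
            order_isomorphic [\<pi> ! i, \<pi> ! (i + 1), \<pi> ! j] [1, 3, 2])"

text \<open>The second disjunct is the convention that the empty permutation begins with the
  pattern \<open>1\<close>.\<close>

definition begins_with :: "nat list \<Rightarrow> nat list \<Rightarrow> bool" where
  "begins_with \<pi> p \<longleftrightarrow>
     length \<pi> \<ge> length p \<and> order_isomorphic (take (length p) \<pi>) p \<or>
     \<pi> = [] \<and> p = [1]"

definition N_13_2 :: "nat list \<Rightarrow> nat \<Rightarrow> nat" where
  "N_13_2 p n = card {\<pi> \<in> permutations_of_set {1..n}. \<not> contains_13_2 \<pi> \<and> begins_with \<pi> p}"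

definition G_13_2 :: "nat list \<Rightarrow> real fps" where
  "G_13_2 p = Abs_fps (\<lambda>n. real (N_13_2 p n))"

definition down_up :: "nat \<Rightarrow> nat list" where
  "down_up k = rev [1..<k] @ [k]"

definition catalan :: "nat \<Rightarrow> real" where
  "catalan n = real (2 * n choose n) / real (n + 1)"

definition catalan_fps :: "real fps" where
  "catalan_fps = Abs_fps catalan"

end

(* An occurrence of 1-3-2 whose first two letters are not adjacent can be tightened to one of
   13-2 by looking at the step that crosses the value of the last letter. So the avoiders of
   13-2 are those of 1-3-2; splitting at the maximum yields the Catalan recurrence for them.
   If an avoider begins with (k-1)...1k, its letters in positions k-1 and k admit no later letter
   of intermediate value, so its first k letters are a + k - 2, ..., a + 1, a, a + k - 1.
   Deleting the first k - 1 letters is then a bijection onto the nonempty avoiders of length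
   n - (k - 1). *)
theory Submission
  imports Defs
begin

section \<open>Catalan numbers\<close>

text \<open>Both central binomials are written through factorials, and a common nonzero factor
  cancels. In this first-order form the recurrence translates into a differential equation.\<close>

lemma catalan_Suc: "real (n + 2) * catalan (Suc n) = real (4 * n + 2) * catalan n"
proof -
  have 1: "real (2 * n choose n) * fact n * fact n = fact (2 * n)"
    using binomial_fact_lemma[of n "2 * n"]
    by (metis (no_types, lifting) add_diff_cancel_left' le_add1 mult.assoc mult.commute mult_2
        of_nat_fact of_nat_mult)
  have "real (2 * Suc n choose Suc n) * fact (Suc n) * fact (Suc n) = fact (2 * Suc n)"
    using binomial_fact_lemma[of "Suc n" "2 * Suc n"]
    by (metis (no_types, lifting) add_diff_cancel_left' le_add1 mult.assoc mult.commute mult_2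
        of_nat_fact of_nat_mult)
  also have "\<dots> = real (2 * n + 2) * (2 * n + 1) * fact (2 * n)"
    by (simp add: algebra_simps)
  finally have "(real (2 * Suc n choose Suc n) * real (n + 1)) * (real (n + 1) * (fact n * fact n)) =
      (real (2 * n choose n) * real (4 * n + 2)) * (real (n + 1) * (fact n * fact n))"
    unfolding 1[symmetric] by (simp add: algebra_simps)
  then have "real (2 * Suc n choose Suc n) * real (n + 1) = real (2 * n choose n) * real (4 * n + 2)"
    by (subst (asm) mult_right_cancel) auto
  then show ?thesis
    by (simp add: catalan_def field_simps del: binomial_Suc_Suc)
qed

lemma fps_numeral_mult_nth: "fps_nth (numeral c * f) n = numeral c * fps_nth f n"
  by (simp add: numeral_fps_const)

text \<open>The series \<open>F\<close> = 1 - 2xC plays the square root of 1 - 4x. The recurrence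
  gives (1 - 4x)F' = -2F, hence (1 - 4x)(F^2)' = -4F^2, which together with F(0) = 1 forces F^2 = 1
  - 4x.\<close>

lemma catalan_fps_eq:
  includes fps_syntax
  shows "catalan_fps = 1 + fps_X * catalan_fps ^ 2"
proof -
  define F where "F = 1 - 2 * fps_X * catalan_fps"
  have F_nth: "F $ Suc n = - 2 * catalan n" for n
    by (simp add: F_def catalan_fps_def mult.assoc fps_numeral_mult_nth)
  have F_0: "F $ 0 = 1"
    by (simp add: F_def)
  have coeff_Suc: "((1 - 4 * fps_X) * g) $ Suc m = g $ Suc m - 4 * g $ m" for g :: "real fps" and m
    by (simp add: left_diff_distrib mult.assoc fps_numeral_mult_nth)
  have ode: "(1 - 4 * fps_X) * fps_deriv F = - 2 * F"
  proof (rule fps_ext)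
    fix n
    show "((1 - 4 * fps_X) * fps_deriv F) $ n = (- 2 * F) $ n"
    proof (cases n)
      case 0
      then show ?thesis
        using F_nth[of 0] F_0
        by (simp add: catalan_def)
    next
      case (Suc m)
      have "((1 - 4 * fps_X) * fps_deriv F) $ n = fps_deriv F $ Suc m - 4 * fps_deriv F $ m"
        unfolding Suc by (rule coeff_Suc)
      also have "\<dots> = - 2 * (real (m + 2) * catalan (Suc m)) + 8 * real (m + 1) * catalan m"
        by (simp add: F_nth algebra_simps)
      also have "\<dots> = 4 * catalan m"
        unfolding catalan_Suc by (simp add: algebra_simps)
      also have "\<dots> = (- 2 * F) $ n"
        by (simp add: Suc F_nth fps_numeral_mult_nth)
      finally show ?thesis .
    qed
  qed
  have "(1 - 4 * fps_X) * fps_deriv (F ^ 2) = 2 * F * ((1 - 4 * fps_X) * fps_deriv F)"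
    by (simp add: power2_eq_square algebra_simps)
  also have "\<dots> = - 4 * F ^ 2"
    unfolding ode by (simp add: power2_eq_square)
  finally have ode2: "(1 - 4 * fps_X) * fps_deriv (F ^ 2) = - 4 * F ^ 2" .
  \<comment> \<open>Coefficient of x^(m+1) in \<open>ode2\<close>. The factor \<open>m\<close> kills
    the coefficient of x^2 at \<open>m = 0\<close>, and all later ones then vanish by
    induction.\<close>
  have step: "real (Suc (Suc m)) * F ^ 2 $ Suc (Suc m) = 4 * real m * F ^ 2 $ Suc m" for m
    using coeff_Suc[of "fps_deriv (F ^ 2)" m]
    unfolding ode2 by (simp add: fps_numeral_mult_nth algebra_simps)
  have "((1 - 4 * fps_X) * fps_deriv (F ^ 2)) $ 0 = (- 4 * F ^ 2) $ 0"
    unfolding ode2 ..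
  then have one: "F ^ 2 $ 1 = - 4"
    using F_0 by (simp add: power2_eq_square)
  have "F ^ 2 = 1 - 4 * fps_X"
  proof (rule fps_ext)
    fix n
    have zero: "F ^ 2 $ Suc (Suc m) = 0" for m
    proof (induction m)
      case 0
      then show ?case using step[of 0] by simp
    next
      case (Suc m)
      then show ?case using step[of "Suc m"] by simp
    qed
    consider "n = 0" | "n = 1" | m where "n = Suc (Suc m)"
      by (metis One_nat_def not0_implies_Suc)
    then show "F ^ 2 $ n = (1 - 4 * fps_X) $ n"
      by cases (use one F_0 zero in \<open>simp_all add: power2_eq_square fps_numeral_nth\<close>)
  qed
  then have "4 * fps_X * (catalan_fps - 1 - fps_X * catalan_fps ^ 2) = 0"
    by (simp add: F_def power2_eq_square algebra_simps)
  then have "catalan_fps - 1 - fps_X * catalan_fps ^ 2 = 0"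
    by simp
  then show ?thesis
    by (simp add: algebra_simps)
qed

lemma catalan_rec:
  includes fps_syntax
  shows "catalan (Suc n) = (\<Sum>q\<le>n. catalan (n - q) * catalan q)"
proof -
  have "catalan (Suc n) = catalan_fps $ Suc n"
    by (simp add: catalan_fps_def)
  also have "\<dots> = (catalan_fps * catalan_fps) $ n"
    by (subst catalan_fps_eq) (simp add: power2_eq_square)
  also have "\<dots> = (\<Sum>q\<le>n. catalan (n - q) * catalan q)"
    by (simp add: fps_mult_nth catalan_fps_def atLeast0AtMost mult.commute)
  finally show ?thesis .
qed

section \<open>Avoidance of 13-2 and of 1-3-2\<close>

lemma contains_13_2_iff:
  "contains_13_2 xs \<longleftrightarrow> (\<exists>i j. i + 1 < j \<and> j < length xs \<and> xs ! i < xs ! j \<and> xs ! j < xs ! (i + 1))"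
proof -
  have "order_isomorphic [a, c, b] [1, 3, 2] \<longleftrightarrow> a < b \<and> b < c" for a b c
    by (auto simp: order_isomorphic_def All_less_Suc)
  then show ?thesis
    by (simp add: contains_13_2_def)
qed

lemma contains_13_2_Nil [simp]: "\<not> contains_13_2 []"
  and contains_13_2_single [simp]: "\<not> contains_13_2 [x]"
  by (auto simp: contains_13_2_iff)

lemma contains_13_2_Cons_Cons:
  \<comment> \<open>An occurrence either starts at \<open>x\<close>, so that its adjacent pair is
    \<open>x\<close>, \<open>y\<close>, or lies entirely in \<open>y # xs\<close>.\<close>
  "contains_13_2 (x # y # xs) \<longleftrightarrow> contains_13_2 (y # xs) \<or> (\<exists>z\<in>set xs. x < z \<and> z < y)"
  (is "?l \<longleftrightarrow> ?r")
proof
  assume ?l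
  then obtain i j where ij: "i + 1 < j" "j < length (x # y # xs)"
      "(x # y # xs) ! i < (x # y # xs) ! j" "(x # y # xs) ! j < (x # y # xs) ! (i + 1)"
    unfolding contains_13_2_iff by blast
  then obtain j' where j: "j = Suc j'"
    by (cases j) auto
  show ?r
  proof (cases i)
    case 0
    with ij j show ?thesis
      by (auto simp: nth_Cons' intro!: bexI[of _ "xs ! (j' - 1)"])
  next
    case (Suc i')
    with ij j have "contains_13_2 (y # xs)"
      unfolding contains_13_2_iff by (intro exI[of _ i'] exI[of _ j']) auto
    then show ?thesis ..
  qed
next
  assume ?r
  then show ?l
  proof
    assume "contains_13_2 (y # xs)"
    then obtain i j where "i + 1 < j" "j < length (y # xs)"
      "(y # xs) ! i < (y # xs) ! j" "(y # xs) ! j < (y # xs) ! (i + 1)"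
      unfolding contains_13_2_iff by blast
    then show ?l
      unfolding contains_13_2_iff by (intro exI[of _ "Suc i"] exI[of _ "Suc j"]) auto
  next
    assume "\<exists>z\<in>set xs. x < z \<and> z < y"
    then obtain j where "j < length xs" "x < xs ! j" "xs ! j < y"
      by (auto simp: in_set_conv_nth)
    then show ?l
      unfolding contains_13_2_iff by (intro exI[of _ 0] exI[of _ "Suc (Suc j)"]) auto
  qed
qed

lemma contains_13_2_map:
  assumes "strict_mono f"
  shows "contains_13_2 (map f xs) \<longleftrightarrow> contains_13_2 xs"
proof -
  have "map f xs ! i < map f xs ! j \<longleftrightarrow> xs ! i < xs ! j" if "i < length xs" "j < length xs" for i j
    using that assms by (simp add: strict_mono_less)
  then show ?thesis
    unfolding contains_13_2_iff by (intro iff_exI conj_cong refl) auto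
qed

text \<open>The classical pattern without adjacency: \<open>x\<close> plays the 1, and
  \<open>sorted_wrt\<close> runs over all pairs of later letters, \<open>c\<close> before
  \<open>b\<close>, as candidates for 3 and 2.\<close>

fun avoids_1_3_2 :: "nat list \<Rightarrow> bool" where
  "avoids_1_3_2 [] \<longleftrightarrow> True"
| "avoids_1_3_2 (x # xs) \<longleftrightarrow> sorted_wrt (\<lambda>c b. \<not> (x < b \<and> b < c)) xs \<and> avoids_1_3_2 xs"

text \<open>Checking the adjacent pair \<open>x\<close>, \<open>y\<close> suffices: if no later
  letter lies strictly between them, then an occurrence \<open>x\<close>, \<open>c\<close>,
  \<open>b\<close> inside the rest has \<open>y < b\<close>, as distinctness excludes
  \<open>b = y\<close>, so \<open>y\<close>, \<open>c\<close>, \<open>b\<close> is already an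
  occurrence.\<close>

lemma avoids_1_3_2_iff: "distinct xs \<Longrightarrow> avoids_1_3_2 xs \<longleftrightarrow> \<not> contains_13_2 xs"
proof (induction xs rule: induct_list012)
  case (3 x y xs)
  have "sorted_wrt (\<lambda>c b. \<not> (x < b \<and> b < c)) xs"
    if "avoids_1_3_2 (y # xs)" "\<forall>z\<in>set xs. \<not> (x < z \<and> z < y)"
  proof (rule sorted_wrt_mono_rel)
    show "sorted_wrt (\<lambda>c b. \<not> (y < b \<and> b < c)) xs"
      using that by simp
    show "\<not> (x < b \<and> b < c)" if "c \<in> set xs" "b \<in> set xs" "\<not> (y < b \<and> b < c)" for c b
      using that \<open>\<forall>z\<in>set xs. \<not> (x < z \<and> z < y)\<close> 3(3)
      by (metis distinct.simps(2) linorder_neqE_nat)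
  qed
  then have "avoids_1_3_2 (x # y # xs) \<longleftrightarrow> avoids_1_3_2 (y # xs) \<and> (\<forall>z\<in>set xs. \<not> (x < z \<and> z < y))"
    by auto
  then show ?case
    using 3 contains_13_2_Cons_Cons[of x y xs] by (simp del: avoids_1_3_2.simps)
qed simp_all

lemma sorted_wrt_below:
  fixes x :: nat
  shows "\<forall>r\<in>set R. r \<le> x \<Longrightarrow> sorted_wrt (\<lambda>c b. \<not> (x < b \<and> b < c)) R"
  by (induction R) auto

text \<open>With \<open>m\<close> as the 3, no letter of \<open>L\<close> may be below a letter of
  \<open>R\<close>. Conversely, once \<open>R\<close> lies below \<open>L\<close>, an occurrence
  whose 1 is in \<open>L\<close> must have its 2 in \<open>L\<close> as well, so none straddles
  \<open>m\<close>.\<close>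

lemma avoids_1_3_2_max:
  assumes "\<And>x. x \<in> set L \<union> set R \<Longrightarrow> x < m"
  shows "avoids_1_3_2 (L @ m # R) \<longleftrightarrow>
    avoids_1_3_2 L \<and> avoids_1_3_2 R \<and> (\<forall>l\<in>set L. \<forall>r\<in>set R. r \<le> l)"
  using assms
proof (induction L)
  case Nil
  then show ?case
    using sorted_wrt_below[of R m] by (simp add: less_imp_le)
next
  case (Cons x L)
  have m: "\<forall>r\<in>set R. r < m" "\<forall>l\<in>set L. l < m"
    using Cons.prems by auto
  have "sorted_wrt (\<lambda>c b. \<not> (x < b \<and> b < c)) (L @ m # R) \<longleftrightarrow>
      sorted_wrt (\<lambda>c b. \<not> (x < b \<and> b < c)) L \<and> (\<forall>r\<in>set R. r \<le> x)" (is "?l \<longleftrightarrow> ?r")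
  proof
    assume ?l
    then show ?r
      using m by (auto simp: sorted_wrt_append not_less) (meson leD)
  next
    assume ?r
    then show ?l
      using m sorted_wrt_below[of R x] by (auto simp: sorted_wrt_append not_less dest: less_imp_le)
  qed
  then show ?case
    using Cons by auto
qed

section \<open>Counting avoiders\<close>

text \<open>The start \<open>a\<close> is free because the two sides of the maximum occupy intervals
  with different starts.\<close>

definition avoiders :: "nat \<Rightarrow> nat \<Rightarrow> nat list set" where
  "avoiders a n = {\<pi> \<in> permutations_of_set {a..<a + n}. \<not> contains_13_2 \<pi>}"

lemma in_avoiders_iff:
  "\<pi> \<in> avoiders a n \<longleftrightarrow> set \<pi> = {a..<a + n} \<and> distinct \<pi> \<and> avoids_1_3_2 \<pi>"
  by (auto simp: avoiders_def permutations_of_set_def avoids_1_3_2_iff)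

lemma finite_avoiders [simp]: "finite (avoiders a n)"
  by (simp add: avoiders_def)

text \<open>The cut is at the minimum of \<open>A\<close>, or at the upper end if \<open>A\<close>
  is empty. The last interval is written in the shape used by
  \<open>avoiders (a + q) (n - q)\<close>.\<close>

lemma interval_split:
  fixes A B :: "nat set"
  assumes "A \<union> B = {a..<a + n}" "\<And>x y. x \<in> A \<Longrightarrow> y \<in> B \<Longrightarrow> y < x"
  obtains q where "q \<le> n" "B = {a..<a + q}" "A = {a + q..<a + q + (n - q)}"
proof (cases "A = {}")
  case True
  then show ?thesis using that[of n] assms by auto
next
  case False
  have fin: "finite A"
    using assms(1) by (metis finite_Un finite_atLeastLessThan)
  then have m: "Min A \<in> A" "\<And>x. x \<in> A \<Longrightarrow> Min A \<le> x"
    using False by auto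
  then have "Min A \<in> {a..<a + n}"
    using assms(1) by blast
  then obtain q where q: "Min A = a + q" "q < n"
    by (metis add_less_cancel_left atLeastLessThan_iff le_Suc_ex)
  have "x \<in> A \<longleftrightarrow> a + q \<le> x" "x \<in> B \<longleftrightarrow> x < a + q" if "x \<in> {a..<a + n}" for x
    using that assms m q(1) by (metis UnE leD not_less)+
  then have "B = {x \<in> {a..<a + n}. x < a + q}" "A = {x \<in> {a..<a + n}. a + q \<le> x}"
    using assms(1) by blast+
  then have "B = {a..<a + q}" "A = {a + q..<a + n}"
    using q(2) by auto
  then show ?thesis
    using that[of q] q by simp
qed

text \<open>Cutting at the maximum \<open>a + n\<close>: by \<open>avoids_1_3_2_max\<close> the part
  after it takes the \<open>q\<close> smallest values and the part before it the remaining
  \<open>n - q\<close>.\<close>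

lemma bij_betw_avoiders_Suc:
  "bij_betw (\<lambda>(q, L, R). L @ (a + n) # R)
     (SIGMA q:{..n}. avoiders (a + q) (n - q) \<times> avoiders a q) (avoiders a (Suc n))"
  (is "bij_betw ?f ?S _")
proof (rule bij_betwI')
  fix s t
  assume s: "s \<in> ?S" and t: "t \<in> ?S"
  obtain q L R where [simp]: "s = (q, L, R)"
    by (cases s)
  obtain q' L' R' where [simp]: "t = (q', L', R')"
    by (cases t)
  \<comment> \<open>The maximum occurs only once, so the word determines \<open>L\<close> and
    \<open>R\<close>, and \<open>q\<close> is the length of \<open>R\<close>.\<close>
  have "a + n \<notin> set L" "a + n \<notin> set R" "a + n \<notin> set L'" "a + n \<notin> set R'"
    using s t by (auto simp: in_avoiders_iff)
  moreover have "length R = q" "length R' = q'"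
    using s t by (auto simp: in_avoiders_iff dest!: distinct_card)
  ultimately show "(?f s = ?f t) = (s = t)"
    by (auto simp: append_Cons_eq_iff)
next
  fix s
  assume s: "s \<in> ?S"
  obtain q L R where [simp]: "s = (q, L, R)"
    by (cases s)
  have "avoids_1_3_2 (L @ (a + n) # R)"
    using s by (subst avoids_1_3_2_max) (auto simp: in_avoiders_iff)
  then show "?f s \<in> avoiders a (Suc n)"
    using s by (auto simp: in_avoiders_iff)
next
  fix \<pi>
  assume \<pi>: "\<pi> \<in> avoiders a (Suc n)"
  then have "a + n \<in> set \<pi>"
    by (auto simp: in_avoiders_iff)
  then obtain L R where LR: "\<pi> = L @ (a + n) # R"
    by (meson split_list)
  have "set L \<union> set R = {a..<a + Suc n} - {a + n}"
    using \<pi> by (auto simp: LR in_avoiders_iff)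
  also have "{a..<a + Suc n} - {a + n} = {a..<a + n}"
    by auto
  finally have un: "set L \<union> set R = {a..<a + n}" .
  then have av: "avoids_1_3_2 L" "avoids_1_3_2 R" and le: "\<forall>l\<in>set L. \<forall>r\<in>set R. r \<le> l"
    using \<pi> avoids_1_3_2_max[of L R "a + n"] by (auto simp: LR in_avoiders_iff)
  have dist: "distinct L" "distinct R" "set L \<inter> set R = {}"
    using \<pi> by (auto simp: LR in_avoiders_iff)
  then obtain q where "q \<le> n" "set R = {a..<a + q}" "set L = {a + q..<a + q + (n - q)}"
    using interval_split[OF un] le by (metis disjoint_iff le_neq_implies_less)
  then have "(q, L, R) \<in> ?S"
    using av dist(1,2) by (simp add: in_avoiders_iff)
  then show "\<exists>s\<in>?S. \<pi> = ?f s"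
    using LR by force
qed

lemma card_avoiders: "real (card (avoiders a n)) = catalan n"
proof (induction n arbitrary: a rule: less_induct)
  case (less n)
  show ?case
  proof (cases n)
    case 0
    then have "avoiders a n = {[]}"
      by (auto simp: in_avoiders_iff)
    then show ?thesis
      using 0 by (simp add: catalan_def)
  next
    case (Suc m)
    have "card (avoiders a n) = card (SIGMA q:{..m}. avoiders (a + q) (m - q) \<times> avoiders a q)"
      using bij_betw_same_card[OF bij_betw_avoiders_Suc] Suc by metis
    also have "\<dots> = (\<Sum>q\<le>m. card (avoiders (a + q) (m - q)) * card (avoiders a q))"
      by (simp add: card_cartesian_product)
    finally have "real (card (avoiders a n)) = (\<Sum>q\<le>m. catalan (m - q) * catalan q)"
      using less Suc by simp
    then show ?thesis
      by (simp add: Suc catalan_rec)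
  qed
qed

section \<open>Avoiders with a prescribed beginning\<close>

text \<open>Order-preserving relabelling that vacates the values \<open>{a..<a + j}\<close>.\<close>

definition skip :: "nat \<Rightarrow> nat \<Rightarrow> nat \<Rightarrow> nat" where
  "skip a j v = (if v < a then v else v + j)"

lemma strict_mono_skip: "strict_mono (skip a j)"
  by (auto simp: strict_mono_def skip_def)

text \<open>Inverse of deleting the first \<open>j = k - 1\<close> letters and closing the gap in
  the values: the head moves up by \<open>j\<close>, and the vacated values precede it in decreasing
  order.\<close>

definition prepend_run :: "nat \<Rightarrow> nat list \<Rightarrow> nat list" where
  "prepend_run j \<sigma> = rev [hd \<sigma>..<hd \<sigma> + j] @ map (skip (hd \<sigma>) j) \<sigma>"

text \<open>Adjacent letters of the run descend and cannot serve as 13. The only possible new ascent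
  is from \<open>a\<close> to \<open>b\<close>, and the hypothesis denies it a 2.\<close>

lemma contains_13_2_run:
  assumes "\<And>z. z \<in> set R \<Longrightarrow> \<not> (a < z \<and> z < b)"
  shows "contains_13_2 (rev [a..<a + i] @ b # R) \<longleftrightarrow> contains_13_2 (b # R)"
proof (induction i)
  case (Suc i)
  show ?case
  proof (cases i)
    case 0
    then show ?thesis
      using assms by (auto simp: contains_13_2_Cons_Cons)
  next
    case (Suc i')
    then show ?thesis
      using Suc.IH by (auto simp: contains_13_2_Cons_Cons)
  qed
qed simp

lemma permutations_of_set_interval_iff:
  "\<pi> \<in> permutations_of_set {1..n} \<longleftrightarrow> distinct \<pi> \<and> length \<pi> = n \<and> set \<pi> \<subseteq> {1..n}"
proof
  assume "\<pi> \<in> permutations_of_set {1..n}"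
  then show "distinct \<pi> \<and> length \<pi> = n \<and> set \<pi> \<subseteq> {1..n}"
    using distinct_card[of \<pi>] by (simp add: permutations_of_set_def)
next
  assume *: "distinct \<pi> \<and> length \<pi> = n \<and> set \<pi> \<subseteq> {1..n}"
  then have "set \<pi> = {1..n}"
    by (intro card_subset_eq) (simp_all add: distinct_card)
  then show "\<pi> \<in> permutations_of_set {1..n}"
    using * by (simp add: permutations_of_set_def)
qed

lemma in_avoiders_1_iff:
  "\<pi> \<in> avoiders 1 n \<longleftrightarrow> distinct \<pi> \<and> length \<pi> = n \<and> set \<pi> \<subseteq> {1..n} \<and> \<not> contains_13_2 \<pi>"
proof -
  have "{1..<1 + n} = {1..n}"
    by auto
  then show ?thesis
    unfolding avoiders_def using permutations_of_set_interval_iff[of \<pi> n] by auto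
qed

section \<open>Order isomorphism with the pattern (k-1)...1k\<close>

lemma length_down_up [simp]: "length (down_up (Suc j)) = Suc j"
  by (simp add: down_up_def)

lemma nth_down_up: "i \<le> j \<Longrightarrow> down_up (Suc j) ! i = (if i = j then Suc j else j - i)"
  by (auto simp: down_up_def nth_append rev_nth simp del: upt_Suc)

text \<open>The hypothesis makes the word nonempty, so the convention for the empty permutation does
  not interfere.\<close>

lemma begins_with_down_up_iff:
  assumes "j < length \<pi>"
  shows "begins_with \<pi> (down_up (Suc j)) \<longleftrightarrow>
    sorted_wrt (>) (take j \<pi>) \<and> (\<forall>x\<in>set (take j \<pi>). x < \<pi> ! j)" (is "?l \<longleftrightarrow> ?r")
proof -
  have "?l \<longleftrightarrow> (\<forall>i\<le>j. \<forall>l\<le>j. \<pi> ! i < \<pi> ! l \<longleftrightarrow> down_up (Suc j) ! i < down_up (Suc j) ! l)"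
    using assms by (auto simp: begins_with_def order_isomorphic_def less_Suc_eq_le)
  \<comment> \<open>Only the inequalities that hold in the pattern are kept; by trichotomy they
    decide all the others.\<close>
  also have "\<dots> \<longleftrightarrow> (\<forall>i<j. \<pi> ! i < \<pi> ! j \<and> (\<forall>l<i. \<pi> ! i < \<pi> ! l))" (is "?m \<longleftrightarrow> ?n")
  proof
    assume m: ?m
    show ?n
    proof (intro allI impI conjI)
      fix i assume "i < j"
      then show "\<pi> ! i < \<pi> ! j"
        using m by (auto simp: nth_down_up)
      fix l assume "l < i"
      with \<open>i < j\<close> have "down_up (Suc j) ! i < down_up (Suc j) ! l"
        by (simp add: nth_down_up)
      then show "\<pi> ! i < \<pi> ! l"
        using m \<open>i < j\<close> \<open>l < i\<close> by simp
    qed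
  next
    assume n: ?n
    have dec: "\<pi> ! i < \<pi> ! l" if "l < i" "i < j" for i l
      using n that by blast
    have top: "\<pi> ! i < \<pi> ! j" if "i < j" for i
      using n that by blast
    show ?m
    proof (intro allI impI)
      fix i l assume "i \<le> j" "l \<le> j"
      consider "i = l" | "i < l" "l < j" | "i < l" "l = j" | "l < i" "i < j" | "l < i" "i = j"
        using \<open>i \<le> j\<close> \<open>l \<le> j\<close> by linarith
      then show "\<pi> ! i < \<pi> ! l \<longleftrightarrow> down_up (Suc j) ! i < down_up (Suc j) ! l"
        by cases (use dec[of i l] dec[of l i] top[of i] top[of l] in \<open>auto simp: nth_down_up\<close>)
    qed
  qed
  also have "\<dots> \<longleftrightarrow> ?r"
    using assms by (auto simp: sorted_wrt_iff_nth_less in_set_conv_nth Ball_def)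
  finally show ?thesis .
qed

text \<open>Both runs have length \<open>j\<close>, so the remainders agree. The first letter of a
  remainder is \<open>hd \<sigma> + j\<close>, which reveals the relabelling, and
  \<open>skip\<close> is injective.\<close>

lemma inj_on_prepend_run:
  assumes "[] \<notin> S"
  shows "inj_on (prepend_run j) S"
proof (rule inj_onI)
  fix \<sigma> \<tau>
  assume "\<sigma> \<in> S" "\<tau> \<in> S" and eq: "prepend_run j \<sigma> = prepend_run j \<tau>"
  then have ne: "\<sigma> \<noteq> []" "\<tau> \<noteq> []"
    using assms by auto
  have maps: "map (skip (hd \<sigma>) j) \<sigma> = map (skip (hd \<tau>) j) \<tau>"
    using eq by (simp add: prepend_run_def)
  then have "skip (hd \<sigma>) j (hd \<sigma>) = skip (hd \<tau>) j (hd \<tau>)"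
    using ne by (metis list.map_sel(1))
  then have "hd \<sigma> = hd \<tau>"
    by (simp add: skip_def)
  then show "\<sigma> = \<tau>"
    using maps strict_mono_skip strict_mono_imp_inj_on by (metis inj_map_eq_map)
qed

lemma prepend_run_image:
  assumes "m > 0"
  shows "prepend_run j ` avoiders 1 m =
    {\<pi> \<in> permutations_of_set {1..m + j}. \<not> contains_13_2 \<pi> \<and> begins_with \<pi> (down_up (Suc j))}"
    (is "_ = ?T")
proof (intro equalityI subsetI)
  {
    fix \<pi>
    assume "\<pi> \<in> prepend_run j ` avoiders 1 m"
    then obtain \<sigma> where "\<sigma> \<in> avoiders 1 m" and \<pi>: "\<pi> = prepend_run j \<sigma>"
      by blast
    then have \<sigma>: "distinct \<sigma>" "length \<sigma> = m" "set \<sigma> \<subseteq> {1..m}" "\<not> contains_13_2 \<sigma>"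
      using in_avoiders_1_iff[of \<sigma> m] by simp_all
    obtain a \<tau> where [simp]: "\<sigma> = a # \<tau>"
      using \<sigma>(2) assms by (cases \<sigma>) auto
    have \<pi>_eq: "\<pi> = rev [a..<a + j] @ (a + j) # map (skip a j) \<tau>"
      by (simp add: \<pi> prepend_run_def skip_def)
    have "distinct (map (skip a j) \<sigma>)"
      using \<sigma>(1) strict_mono_imp_inj_on[OF strict_mono_skip] by (metis distinct_map)
    then have "distinct \<pi>" "length \<pi> = m + j" "set \<pi> \<subseteq> {1..m + j}"
      using \<sigma> by (auto simp: \<pi>_eq skip_def)
    moreover have "\<not> contains_13_2 \<pi>"
    proof -
      \<comment> \<open>No relabelled letter falls strictly between \<open>a\<close> and
        \<open>a + j\<close>, so the run creates no occurrence.\<close>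
      have "contains_13_2 \<pi> \<longleftrightarrow> contains_13_2 (map (skip a j) \<sigma>)"
        unfolding \<pi>_eq by (subst contains_13_2_run) (auto simp: skip_def)
      also have "\<dots> \<longleftrightarrow> contains_13_2 \<sigma>"
        by (rule contains_13_2_map[OF strict_mono_skip])
      finally show ?thesis
        using \<sigma>(4) by simp
    qed
    moreover have "begins_with \<pi> (down_up (Suc j))"
      using assms \<open>length \<pi> = m + j\<close>
      by (subst begins_with_down_up_iff) (auto simp: \<pi>_eq sorted_wrt_rev nth_append)
    ultimately show "\<pi> \<in> ?T"
      using permutations_of_set_interval_iff[of \<pi> "m + j"] by simp
  }
  fix \<pi>
  assume "\<pi> \<in> ?T"
  then have perm: "distinct \<pi>" "length \<pi> = m + j" "set \<pi> = {1..m + j}"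
    and nc: "\<not> contains_13_2 \<pi>" and bw: "begins_with \<pi> (down_up (Suc j))"
    using distinct_card[of \<pi>] by (simp_all add: permutations_of_set_def)
  define D b R where "D = take j \<pi>" and "b = \<pi> ! j" and "R = drop (Suc j) \<pi>"
  have \<pi>_eq: "\<pi> = D @ b # R"
    using perm(2) assms by (simp add: D_def b_def R_def Cons_nth_drop_Suc)
  have D: "length D = j" "sorted_wrt (>) D" "\<And>x. x \<in> set D \<Longrightarrow> x < b"
    using bw perm(2) assms begins_with_down_up_iff[of j \<pi>] by (auto simp: D_def b_def)
  have mem: "1 \<le> x" "x \<le> m + j" if "x \<in> set D \<union> set (b # R)" for x
    using that perm(3) by (auto simp: \<pi>_eq)
  \<comment> \<open>The last letter \<open>a\<close> of \<open>D\<close> is its least. A value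
    strictly between \<open>a\<close> and \<open>b\<close> cannot come after \<open>b\<close>, so
    all such values lie in \<open>D\<close>, and counting them gives \<open>b = a + j\<close>. The
    bound \<open>j < b\<close> keeps the subtraction from truncating and makes \<open>a\<close>
    positive.\<close>
  have "set D = {b - j..<b} \<and> j < b"
  proof (cases D rule: rev_cases)
    case Nil
    then show ?thesis
      using D(1) mem[of b] by simp
  next
    case (snoc D' a)
    have gap: "\<not> (a < z \<and> z < b)" if z: "z \<in> set R" for z
    proof
      assume "a < z \<and> z < b"
      moreover obtain l where "l < length R" "R ! l = z"
        using z by (auto simp: in_set_conv_nth)
      ultimately have "contains_13_2 \<pi>"
        unfolding contains_13_2_iff \<pi>_eq snoc
        \<comment> \<open>The adjacent pair \<open>a\<close>, \<open>b\<close> sits right after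
          \<open>D'\<close>, hence the offset 2 for the position of \<open>z\<close>.\<close>
        by (intro exI[of _ "length D'"] exI[of _ "length D' + 2 + l"]) (auto simp: nth_append)
      with nc show False ..
    qed
    have "{a<..<b} \<subseteq> set D'"
    proof
      fix z
      assume z: "z \<in> {a<..<b}"
      then have "z \<in> set \<pi>"
        unfolding perm(3) using mem(2)[of b] by simp
      then show "z \<in> set D'"
        using gap[of z] z by (auto simp: \<pi>_eq snoc)
    qed
    moreover have "set D' \<subseteq> {a<..<b}"
      using D by (auto simp: snoc sorted_wrt_append)
    ultimately have D': "set D' = {a<..<b}"
      by blast
    have "distinct D'"
      using perm(1) by (simp add: \<pi>_eq snoc)
    then have "b - Suc a = length D'"
      using distinct_card[of D'] by (simp add: D')
    then have "b = a + j"
      using D(1) D(3)[of a] by (simp add: snoc)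
    then show ?thesis
      using D(1) D' mem[of a] by (auto simp: snoc)
  qed
  then obtain a where set_D: "set D = {a..<a + j}" and b: "b = a + j" and "a > 0"
    using that[of "b - j"] by (simp add: less_imp_le)
  have "sorted (rev D)"
    unfolding sorted_wrt_rev using D(2) by (rule sorted_wrt_mono_rel[rotated]) simp
  then have "rev D = [a..<a + j]"
    by (rule sorted_distinct_set_unique) (use perm(1) set_D in \<open>simp_all add: \<pi>_eq\<close>)
  then have D_eq: "D = rev [a..<a + j]"
    by (metis rev_rev_ident)
  have out: "x < a \<or> a + j \<le> x" if "x \<in> set (b # R)" for x
    using that perm(1) set_D by (auto simp: \<pi>_eq b not_less)
  \<comment> \<open>Closing the gap sends \<open>b = a + j\<close> to \<open>a\<close>; on letters
    outside \<open>{a..<a + j}\<close> this is undone by \<open>skip a j\<close>.\<close>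
  define \<sigma> where "\<sigma> = map (\<lambda>v. if v < a then v else v - j) (b # R)"
  have hd: "hd \<sigma> = a" and len: "length \<sigma> = m"
    using perm(2) D(1) by (simp_all add: \<sigma>_def b \<pi>_eq)
  have skip_\<sigma>: "map (skip a j) \<sigma> = b # R"
    unfolding \<sigma>_def map_map by (rule map_idI) (use out in \<open>fastforce simp: skip_def\<close>)
  then have \<pi>_run: "\<pi> = prepend_run j \<sigma>"
    by (simp add: prepend_run_def hd \<pi>_eq D_eq)
  have "distinct (map (skip a j) \<sigma>)"
    using perm(1) by (simp add: skip_\<sigma> \<pi>_eq)
  then have "distinct \<sigma>"
    by (simp add: distinct_map)
  moreover have "set \<sigma> \<subseteq> {1..m}"
  proof
    fix y
    assume "y \<in> set \<sigma>"
    then obtain v where v: "v \<in> set (b # R)" "y = (if v < a then v else v - j)"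
      unfolding \<sigma>_def set_map by blast
    then show "y \<in> {1..m}"
      \<comment> \<open>For \<open>v < a\<close> the bound by \<open>m\<close> comes from
        \<open>a + j = b\<close> and \<open>b \<le> m + j\<close>.\<close>
      using out[of v] mem[of v] mem[of b] b \<open>a > 0\<close> by auto
  qed
  moreover have "\<not> contains_13_2 \<sigma>"
  proof -
    have "contains_13_2 \<pi> \<longleftrightarrow> contains_13_2 (b # R)"
      unfolding \<pi>_eq D_eq by (rule contains_13_2_run) (use out b in fastforce)
    then show ?thesis
      using nc by (metis contains_13_2_map skip_\<sigma> strict_mono_skip)
  qed
  ultimately have "\<sigma> \<in> avoiders 1 m"
    using len in_avoiders_1_iff[of \<sigma> m] by simp
  then show "\<pi> \<in> prepend_run j ` avoiders 1 m"
    using \<pi>_run by blast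
qed

section \<open>Coefficients and generating function\<close>

lemma N_13_2_down_up:
  "real (N_13_2 (down_up (Suc j)) n) =
     (if Suc j \<le> n then catalan (n - j) else 0) + of_bool (j = 0 \<and> n = 0)"
proof (cases "Suc j \<le> n")
  case True
  then have "[] \<notin> avoiders 1 (n - j)"
    by (auto simp: in_avoiders_iff)
  then have "card (prepend_run j ` avoiders 1 (n - j)) = card (avoiders 1 (n - j))"
    by (intro card_image inj_on_prepend_run)
  then have "N_13_2 (down_up (Suc j)) n = card (avoiders 1 (n - j))"
    using True prepend_run_image[of "n - j" j]
    by (simp add: N_13_2_def)
  then show ?thesis
    using True card_avoiders by simp
next
  case False
  have single: "down_up (Suc j) = [1] \<longleftrightarrow> j = 0"
    using length_down_up[of j] by (auto simp: down_up_def)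
  \<comment> \<open>The word is shorter than the pattern, so only the convention for the empty
    permutation can apply.\<close>
  have "\<not> contains_13_2 \<pi> \<and> begins_with \<pi> (down_up (Suc j)) \<longleftrightarrow> \<pi> = [] \<and> j = 0"
    if "\<pi> \<in> permutations_of_set {1..n}" for \<pi>
  proof -
    have "length \<pi> = n"
      using that permutations_of_set_interval_iff by blast
    then show ?thesis
      using False single by (auto simp: begins_with_def)
  qed
  then have "N_13_2 (down_up (Suc j)) n = card {\<pi> \<in> permutations_of_set {1..n}. \<pi> = [] \<and> j = 0}"
    unfolding N_13_2_def by (intro arg_cong[where f = card] Collect_cong) blast
  also have "{\<pi> \<in> permutations_of_set {1..n}. \<pi> = [] \<and> j = 0} = (if j = 0 \<and> n = 0 then {[]} else {})"
    by (auto simp: permutations_of_set_def)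
  finally show ?thesis
    using False by simp
qed

(* The of_bool terms account for the empty permutation, which by convention begins with the
   pattern 1; they vanish unless k = 1 (and n = 0). *)
theorem proposition17:
  fixes k :: nat
  assumes "k \<ge> 1"
  shows "G_13_2 (down_up k) = fps_X ^ k * catalan_fps ^ 2 + of_bool (k = 1) \<and>
         (\<forall>n. real (N_13_2 (down_up k) n) =
                (if n \<ge> k then catalan (n - (k - 1)) else 0) + of_bool (k = 1 \<and> n = 0))"
proof -
  obtain j where k: "k = Suc j"
    using assms by (cases k) auto
  have coeff: "real (N_13_2 (down_up k) n) =
      (if n \<ge> k then catalan (n - (k - 1)) else 0) + of_bool (k = 1 \<and> n = 0)" for n
    using N_13_2_down_up[of j n] by (simp add: k)
  \<comment> \<open>By C = 1 + xC^2, squaring shifts the coefficients by one; this turns index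
    \<open>n - k\<close> into \<open>n - (k - 1)\<close>.\<close>
  have sq: "fps_nth (catalan_fps ^ 2) i = catalan (Suc i)" for i
  proof -
    have "catalan (Suc i) = fps_nth catalan_fps (Suc i)"
      by (simp add: catalan_fps_def)
    also have "\<dots> = fps_nth (catalan_fps ^ 2) i"
      by (subst catalan_fps_eq) simp
    finally show ?thesis ..
  qed
  have "G_13_2 (down_up k) = fps_X ^ k * catalan_fps ^ 2 + of_bool (k = 1)"
  proof (rule fps_ext)
    fix n
    have "n - k + 1 = n - (k - 1)" if "n \<ge> k"
      using that assms by simp
    then show "fps_nth (G_13_2 (down_up k)) n = fps_nth (fps_X ^ k * catalan_fps ^ 2 + of_bool (k = 1)) n"
      by (auto simp: G_13_2_def coeff fps_X_power_mult_nth sq not_less)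
  qed
  with coeff show ?thesis
    by blast
qed

end
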